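(* Let $\widehat M$ be any maximum a posteriori model, i.e. $\pi(\widehat M|\mathbf{D})=\max_{j\ge 1}\pi(M_j|\mathbf{D})$. If $1-\pi(M^*|\mathbf{D})=o_p(1)$ as $n\to\infty$ (global model selection consistency), then $$\sup_{A\in\mathcal{F}}\left|\Pi(A|\widehat M,\mathbf{D})-\Pi(A|M^*,\mathbf{D})\right|=o_p(1)\quad\text{as } n\to\infty,$$ where $\mathcal{F}$ is the set of all measurable events (the oracle property for MAP model selection).
   Context: $\mathbf{D}$ is the observed data with sample size $n$. There is a countable sequence of candidate models $M_1,M_2,\ldots$, one of which is the true model $M^*$. Model $M_j$ has prior probability $\pi(M_j)$ and proposes a prior $\pi(\theta|M_j)$ for a parameter $\theta$, supported on $\Theta_j$; $\Theta=\cup_j\Theta_j$. Given a nonnegative likelihood or quasi-likelihood $L(\mathbf{D}|\theta,M_j)$ (for example $p(\mathbf{D}|\theta,M_j)$, or $e^{-\lambda R_n(\mathbf{D}|\theta,M_j)}$ for an empirical risk $R_n$ and $\lambda>0$), the joint posterior of $(\theta,M)$ is proportional to $L(\mathbf{D}|\theta,M_j)\pi(\theta|M_j)\pi(M_j)$, normalized to a probability distribution. $\Pi(\cdot|\mathbf{D})$ denotes this posterior probability measure (model averaging), $\pi(M_j|\mathbf{D})$ is the posterior probability of the model $M_j$, and $\Pi(\cdot|M_j,\mathbf{D})$ is the posterior conditional on $M=M_j$. $\Pi(\cdot|M^*,\mathbf{D})$ is called the oracle posterior. Measurable events are events concerning $(\theta,M)$, including those concerning $\theta$ only. All these quantities depend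 on $n$; $o_p(1)$ is with respect to the probability measure of $\mathbf{D}$ as $n\to\infty$. *)

theory Defs
  imports "HOL-Probability.Probability"
begin

text \<open>Model \<open>j :: nat\<close> stands for the \<open>(j + 1)\<close>-st candidate. Priors on the parameter are measures
  on one measurable space \<open>T\<close> (with \<open>space T\<close> the union of the supports), so that events
  concerning \<open>(\<theta>, M)\<close> are the sets of \<open>joint_space T\<close>.\<close>

definition joint_space :: "'p measure \<Rightarrow> ('p \<times> nat) measure" where
  "joint_space T = T \<Otimes>\<^sub>M count_space UNIV"

definition model_event :: "'p measure \<Rightarrow> nat \<Rightarrow> ('p \<times> nat) set" where
  "model_event T j = {x \<in> space (joint_space T). snd x = j}"

definition joint_prior ::
    "'p measure \<Rightarrow> nat pmf \<Rightarrow> (nat \<Rightarrow> 'p measure) \<Rightarrow> ('p \<times> nat) measure" where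
  "joint_prior T mprior prior =
     measure_pmf mprior \<bind> (\<lambda>j. distr (prior j) (joint_space T) (\<lambda>\<theta>. (\<theta>, j)))"

text \<open>Below, \<open>l j \<theta>\<close> is the (quasi-)likelihood of the observed data; the data are already
  plugged in.\<close>

definition evidence ::
    "'p measure \<Rightarrow> nat pmf \<Rightarrow> (nat \<Rightarrow> 'p measure) \<Rightarrow> (nat \<Rightarrow> 'p \<Rightarrow> real) \<Rightarrow> ennreal" where
  "evidence T mprior prior l = (\<integral>\<^sup>+ (\<theta>, j). ennreal (l j \<theta>) \<partial>joint_prior T mprior prior)"

text \<open>This is a probability measure exactly when the evidence is positive and finite; otherwise
  the \<open>ennreal\<close> conventions make it the null measure.\<close>

definition posterior ::
    "'p measure \<Rightarrow> nat pmf \<Rightarrow> (nat \<Rightarrow> 'p measure) \<Rightarrow> (nat \<Rightarrow> 'p \<Rightarrow> real) \<Rightarrow> ('p \<times> nat) measure" where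
  "posterior T mprior prior l =
     density (joint_prior T mprior prior) (\<lambda>(\<theta>, j). ennreal (l j \<theta>) / evidence T mprior prior l)"

definition model_posterior ::
    "'p measure \<Rightarrow> nat pmf \<Rightarrow> (nat \<Rightarrow> 'p measure) \<Rightarrow> (nat \<Rightarrow> 'p \<Rightarrow> real) \<Rightarrow> nat \<Rightarrow> real" where
  "model_posterior T mprior prior l j =
     measure (posterior T mprior prior l) (model_event T j)"

definition posterior_given ::
    "'p measure \<Rightarrow> nat pmf \<Rightarrow> (nat \<Rightarrow> 'p measure) \<Rightarrow> (nat \<Rightarrow> 'p \<Rightarrow> real) \<Rightarrow> nat
      \<Rightarrow> ('p \<times> nat) measure" where
  "posterior_given T mprior prior l j =
     uniform_measure (posterior T mprior prior l) (model_event T j)"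

definition MAP_model ::
    "'p measure \<Rightarrow> nat pmf \<Rightarrow> (nat \<Rightarrow> 'p measure) \<Rightarrow> (nat \<Rightarrow> 'p \<Rightarrow> real) \<Rightarrow> nat \<Rightarrow> bool" where
  "MAP_model T mprior prior l m \<longleftrightarrow>
     (\<forall>j. model_posterior T mprior prior l j \<le> model_posterior T mprior prior l m)"

text \<open>Convergence in probability to zero, where \<open>P n\<close> is the law of the data at sample size \<open>n\<close>.
  The outer measure is used because \<open>measure\<close> of a non-measurable set is \<open>0\<close>; for measurable
  \<open>X n\<close> it is the usual notion, see the lemma below.\<close>

definition small_op_one :: "(nat \<Rightarrow> 'd measure) \<Rightarrow> (nat \<Rightarrow> 'd \<Rightarrow> real) \<Rightarrow> bool" where
  "small_op_one P X \<longleftrightarrow>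
     (\<forall>\<epsilon>>0. (\<lambda>n. outer_measure_of (P n) {d \<in> space (P n). \<epsilon> < \<bar>X n d\<bar>}) \<longlonglongrightarrow> 0)"

lemma small_op_one_measurable:
  assumes "\<And>n. prob_space (P n)" and "\<And>n. X n \<in> borel_measurable (P n)"
  shows "small_op_one P X \<longleftrightarrow>
    (\<forall>\<epsilon>>0. (\<lambda>n. measure (P n) {d \<in> space (P n). \<epsilon> < \<bar>X n d\<bar>}) \<longlonglongrightarrow> 0)"
proof -
  have "outer_measure_of (P n) {d \<in> space (P n). \<epsilon> < \<bar>X n d\<bar>}
      = ennreal (measure (P n) {d \<in> space (P n). \<epsilon> < \<bar>X n d\<bar>})" for n \<epsilon>
  proof -
    interpret prob_space "P n" by fact
    have [measurable]: "X n \<in> borel_measurable (P n)" by fact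
    show ?thesis by (simp add: emeasure_eq_measure)
  qed
  moreover have "(\<lambda>n. ennreal (f n)) \<longlonglongrightarrow> 0 \<longleftrightarrow> f \<longlonglongrightarrow> 0" if "\<And>n. 0 \<le> f n" for f
    using tendsto_ennreal_iff[of f sequentially 0] that by simp
  ultimately show ?thesis
    unfolding small_op_one_def by simp
qed

lemma joint_prior_emeasure:
  assumes prior: "\<And>j. prob_space (prior j)" "\<And>j. sets (prior j) = sets T"
    and A: "A \<in> sets (joint_space T)"
  shows "emeasure (joint_prior T mprior prior) A
    = (\<Sum>j. ennreal (pmf mprior j) * emeasure (prior j) {\<theta> \<in> space T. (\<theta>, j) \<in> A})"
proof -
  have pair: "(\<lambda>\<theta>. (\<theta>, j)) \<in> prior j \<rightarrow>\<^sub>M joint_space T" for j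
    unfolding joint_space_def measurable_cong_sets[OF prior(2) refl] by measurable
  have "(\<lambda>j. distr (prior j) (joint_space T) (\<lambda>\<theta>. (\<theta>, j)))
      \<in> measure_pmf mprior \<rightarrow>\<^sub>M subprob_algebra (joint_space T)"
    using prob_space_imp_subprob_space[OF prob_space.prob_space_distr[OF prior(1) pair]]
    by (auto simp: space_subprob_algebra)
  then have "emeasure (joint_prior T mprior prior) A
      = (\<integral>\<^sup>+ j. emeasure (distr (prior j) (joint_space T) (\<lambda>\<theta>. (\<theta>, j))) A \<partial>measure_pmf mprior)"
    unfolding joint_prior_def using A by (intro emeasure_bind) auto
  also have "\<dots> = (\<integral>\<^sup>+ j. emeasure (prior j) {\<theta> \<in> space T. (\<theta>, j) \<in> A} \<partial>measure_pmf mprior)"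
    using A pair sets_eq_imp_space_eq[OF prior(2)]
    by (intro nn_integral_cong) (auto simp: emeasure_distr vimage_def Int_def conj_commute)
  also have "\<dots> = (\<Sum>j. ennreal (pmf mprior j) * emeasure (prior j) {\<theta> \<in> space T. (\<theta>, j) \<in> A})"
    by (simp add: nn_integral_measure_pmf nn_integral_count_space_nat)
  finally show ?thesis .
qed

end

(* Two distinct models cannot both have posterior probability above 1/2.  Hence, as soon as the
   true model has posterior probability at least 3/4, it is the only MAP model, and the distance
   in question vanishes.  Where the evidence is 0 or infinite, the posterior is the null measure
   and the true model has posterior probability 0, so these data fall under the same case split. *)
theory Submission
  imports Defs
begin

lemma sets_joint_prior:
  assumes prior: "\<And>j. prob_space (prior j)" "\<And>j. sets (prior j) = sets T"
  shows "sets (joint_prior T mprior prior) = sets (joint_space T)"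
  unfolding joint_prior_def by (rule sets_bind) auto

lemma sets_posterior:
  assumes prior: "\<And>j. prob_space (prior j)" "\<And>j. sets (prior j) = sets T"
  shows "sets (posterior T mprior prior l) = sets (joint_space T)"
  unfolding posterior_def by (simp add: sets_joint_prior[OF prior])

lemma model_event_measurable: "model_event T j \<in> sets (joint_space T)"
  unfolding model_event_def joint_space_def by measurable

text \<open>The total mass is \<open>?Z / ?Z\<close> with \<open>?Z\<close> the evidence, because
  the normalizing constant is exactly the integral of the likelihood. An inequality is stated since
  this quotient is 1 only for positive finite evidence.\<close>

lemma emeasure_posterior_space_le_1:
  assumes prior: "\<And>j. prob_space (prior j)" "\<And>j. sets (prior j) = sets T"
    and l: "\<And>j. l j \<in> borel_measurable T"
  shows "emeasure (posterior T mprior prior l) (space (posterior T mprior prior l)) \<le> 1"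
proof -
  let ?Q = "joint_prior T mprior prior"
  let ?Z = "evidence T mprior prior l"
  have "(\<lambda>(\<theta>, j). ennreal (l j \<theta>)) \<in> borel_measurable (joint_space T)"
    unfolding joint_space_def using l by measurable
  then have m: "(\<lambda>(\<theta>, j). ennreal (l j \<theta>)) \<in> borel_measurable ?Q"
    by (simp add: measurable_cong_sets[OF sets_joint_prior[OF prior] refl])
  \<comment> \<open>Moving the constant divisor out of the case split gives the form that
    \<open>nn_integral_divide\<close> expects.\<close>
  have d: "(\<lambda>(\<theta>, j). ennreal (l j \<theta>) / ?Z) = (\<lambda>x. (case x of (\<theta>, j) \<Rightarrow> ennreal (l j \<theta>)) / ?Z)"
    by auto
  have "emeasure (posterior T mprior prior l) (space (posterior T mprior prior l))
      = (\<integral>\<^sup>+ x. (case x of (\<theta>, j) \<Rightarrow> ennreal (l j \<theta>)) / ?Z \<partial>?Q)"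
    using m unfolding posterior_def d
    by (subst emeasure_density) (auto intro!: nn_integral_cong)
  also have "\<dots> = ?Z / ?Z"
    using m by (simp add: nn_integral_divide evidence_def)
  \<comment> \<open>In \<open>ennreal\<close> both 0 / 0 and \<infinity> / \<infinity> are 0, so the
    bound also covers degenerate evidence.\<close>
  also have "\<dots> \<le> 1"
    by (cases "?Z = 0 \<or> ?Z = \<infinity>") (auto simp: top.not_eq_extremum)
  finally show ?thesis .
qed

text \<open>The events of distinct models are disjoint, as they fix different second coordinates,
  and together they lie in a space of mass at most 1.\<close>

lemma model_posterior_add_le_1:
  assumes prior: "\<And>j. prob_space (prior j)" "\<And>j. sets (prior j) = sets T"
    and l: "\<And>j. l j \<in> borel_measurable T"
    and "i \<noteq> j"
  shows "model_posterior T mprior prior l i + model_posterior T mprior prior l j \<le> 1"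
proof -
  let ?R = "posterior T mprior prior l"
  have le1: "emeasure ?R (space ?R) \<le> 1"
    by (rule emeasure_posterior_space_le_1[OF prior l])
  have "emeasure ?R (space ?R) \<noteq> \<infinity>"
    using le1 by (auto simp: top_unique)
  then interpret finite_measure ?R
    by (rule finite_measureI)
  have "measure ?R (model_event T i) + measure ?R (model_event T j)
      = measure ?R (model_event T i \<union> model_event T j)"
    using \<open>i \<noteq> j\<close>
    by (intro finite_measure_Union[symmetric])
      (auto simp: sets_posterior[OF prior] model_event_measurable, auto simp: model_event_def)
  also have "\<dots> \<le> measure ?R (space ?R)"
    by (rule bounded_measure)
  also have "\<dots> \<le> 1"
    using le1 by (simp add: emeasure_eq_measure)
  finally show ?thesis
    by (simp add: model_posterior_def)
qed

text \<open>A maximizer other than \<open>j\<close> would also have posterior probability above 1/2,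
  and the two would sum to more than 1.\<close>

lemma MAP_model_unique:
  assumes prior: "\<And>j. prob_space (prior j)" "\<And>j. sets (prior j) = sets T"
    and l: "\<And>j. l j \<in> borel_measurable T"
    and MAP: "MAP_model T mprior prior l m"
    and j: "1 / 2 < model_posterior T mprior prior l j"
  shows "m = j"
proof (rule ccontr)
  assume "m \<noteq> j"
  then have "model_posterior T mprior prior l m + model_posterior T mprior prior l j \<le> 1"
    by (rule model_posterior_add_le_1[OF prior l])
  moreover have "model_posterior T mprior prior l j \<le> model_posterior T mprior prior l m"
    using MAP by (simp add: MAP_model_def)
  ultimately show False
    using j by linarith
qed

text \<open>For every \<epsilon> > 0, the set where \<bar>Y\<bar> exceeds \<epsilon> lies inside the
  set where \<bar>X\<bar> exceeds the one fixed \<delta>. Monotonicity of the outer measure then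
  suffices, whether or not \<open>Y n\<close> is measurable; this matters for a supremum over
  possibly uncountably many events.\<close>

lemma small_op_one_if_vanishing:
  assumes X: "small_op_one P X" and "0 < \<delta>"
    and Y: "\<And>n d. d \<in> space (P n) \<Longrightarrow> \<bar>X n d\<bar> \<le> \<delta> \<Longrightarrow> Y n d = 0"
  shows "small_op_one P Y"
  unfolding small_op_one_def
proof (intro allI impI)
  fix \<epsilon> :: real
  assume "0 < \<epsilon>"
  have le: "outer_measure_of (P n) {d \<in> space (P n). \<epsilon> < \<bar>Y n d\<bar>}
      \<le> outer_measure_of (P n) {d \<in> space (P n). \<delta> < \<bar>X n d\<bar>}" for n
    using Y[of _ n] \<open>0 < \<epsilon>\<close> by (intro outer_measure_of_mono) force
  have lim: "(\<lambda>n. outer_measure_of (P n) {d \<in> space (P n). \<delta> < \<bar>X n d\<bar>}) \<longlonglongrightarrow> 0"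
    using X \<open>0 < \<delta>\<close> by (simp add: small_op_one_def)
  show "(\<lambda>n. outer_measure_of (P n) {d \<in> space (P n). \<epsilon> < \<bar>Y n d\<bar>}) \<longlonglongrightarrow> 0"
    by (rule tendsto_sandwich[OF _ _ tendsto_const lim]) (auto simp: le)
qed

theorem theorem2:
  fixes P :: "nat \<Rightarrow> 'd measure"
    and T :: "nat \<Rightarrow> 'p measure"
    and \<Theta> :: "nat \<Rightarrow> nat \<Rightarrow> 'p set"
    and mprior :: "nat \<Rightarrow> nat pmf"
    and prior :: "nat \<Rightarrow> nat \<Rightarrow> 'p measure"
    and L :: "nat \<Rightarrow> 'd \<Rightarrow> nat \<Rightarrow> 'p \<Rightarrow> real"
    and Mstar :: "nat \<Rightarrow> nat"
    and Mhat :: "nat \<Rightarrow> 'd \<Rightarrow> nat"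
  assumes data_law: "\<And>n. prob_space (P n)"
    and supports: "\<And>n j. \<Theta> n j \<in> sets (T n)" "\<And>n. space (T n) = (\<Union>j. \<Theta> n j)"
    and prior_prob: "\<And>n j. prob_space (prior n j)"
    and prior_sets: "\<And>n j. sets (prior n j) = sets (T n)"
    and prior_supp: "\<And>n j. AE \<theta> in prior n j. \<theta> \<in> \<Theta> n j"
    and L_measurable: "\<And>n d j. d \<in> space (P n) \<Longrightarrow> L n d j \<in> borel_measurable (T n)"
    and L_nonneg: "\<And>n d j \<theta>. d \<in> space (P n) \<Longrightarrow> \<theta> \<in> \<Theta> n j \<Longrightarrow> 0 \<le> L n d j \<theta>"
    and normalizable: "\<And>n. AE d in P n. 0 < evidence (T n) (mprior n) (prior n) (L n d)
                             \<and> evidence (T n) (mprior n) (prior n) (L n d) < \<infinity>"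
    and MAP: "\<And>n d. d \<in> space (P n) \<Longrightarrow>
                MAP_model (T n) (mprior n) (prior n) (L n d) (Mhat n d)"
    and consistency: "small_op_one P
          (\<lambda>n d. 1 - model_posterior (T n) (mprior n) (prior n) (L n d) (Mstar n))"
  shows "small_op_one P
          (\<lambda>n d. SUP A\<in>sets (joint_space (T n)).
             \<bar>measure (posterior_given (T n) (mprior n) (prior n) (L n d) (Mhat n d)) A
              - measure (posterior_given (T n) (mprior n) (prior n) (L n d) (Mstar n)) A\<bar>)"
\<comment> \<open>Any threshold strictly between 0 and 1/2 would serve: it has to force the
  posterior probability of the true model above 1/2.\<close>
proof (rule small_op_one_if_vanishing[OF consistency, of "1 / 4"])
  fix n d
  assume d: "d \<in> space (P n)"
    and "\<bar>1 - model_posterior (T n) (mprior n) (prior n) (L n d) (Mstar n)\<bar> \<le> 1 / 4"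
  then have "1 / 2 < model_posterior (T n) (mprior n) (prior n) (L n d) (Mstar n)"
    by linarith
  then have "Mhat n d = Mstar n"
    by (rule MAP_model_unique[OF prior_prob prior_sets L_measurable[OF d] MAP[OF d]])
  then show "(SUP A\<in>sets (joint_space (T n)).
             \<bar>measure (posterior_given (T n) (mprior n) (prior n) (L n d) (Mhat n d)) A
              - measure (posterior_given (T n) (mprior n) (prior n) (L n d) (Mstar n)) A\<bar>) = 0"
    \<comment> \<open>Both conditional posteriors now coincide, so every term is 0; the real
      supremum of the constant 0 is 0 because the family of events is nonempty.\<close>
    by (auto intro!: cSUP_const)
qed simp

end
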